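(* Let $H$ be a connected graph of diameter two, order $n\ge 2$, maximum degree $\Delta$ and algebraic connectivity $\mu$. Then $$\dim_s(H)\ge \left\lceil \frac{n(n-\Delta-1)}{n-\mu}\right\rceil.$$
   Context: All graphs are finite and simple. The algebraic connectivity $\mu$ is the second smallest eigenvalue of the Laplacian matrix $D-A$ of $H$. For a connected graph $X$, $I_X[u,v]$ is the set of vertices on some shortest $u$–$v$ path; $w$ strongly resolves $u,v$ if $v\in I_X[u,w]$ or $u\in I_X[v,w]$; a strong resolving set is a set $S$ such that every two distinct vertices are strongly resolved by some vertex of $S$; the strong metric dimension $\dim_s(X)$ is the minimum size of a strong resolving set. *)

theory Defs
  imports
    "Graph_Theory.Digraph_Component"
    "Graph_Theory.Shortest_Path"
    "Jordan_Normal_Form.Char_Poly"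
    "HOL-Computational_Algebra.Polynomial"
begin

text \<open>
  Finite simple graphs are the structures satisfying the locale \<^locale>\<open>graph\<close>:
  finite, loop-free, symmetric digraphs without parallel arcs, every undirected edge being a
  pair of opposite arcs. Hence \<^const>\<open>out_degree\<close> is the degree of a vertex.
\<close>

definition max_degree :: "('a, 'b) pre_digraph \<Rightarrow> nat" where
  "max_degree G = Max (out_degree G ` verts G)"


subsection \<open>Distance and strong metric dimension\<close>

definition graph_dist :: "('a, 'b) pre_digraph \<Rightarrow> 'a \<Rightarrow> 'a \<Rightarrow> ereal" where
  "graph_dist G u v = wf_digraph.\<mu> G (\<lambda>_. 1) u v"

definition graph_diameter :: "('a, 'b) pre_digraph \<Rightarrow> ereal" where
  "graph_diameter G = (SUP u\<in>verts G. SUP v\<in>verts G. graph_dist G u v)"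

definition shortest_path :: "('a, 'b) pre_digraph \<Rightarrow> 'a \<Rightarrow> 'b list \<Rightarrow> 'a \<Rightarrow> bool" where
  "shortest_path G u p v \<longleftrightarrow>
     pre_digraph.apath G u p v \<and> ereal (real (length p)) = graph_dist G u v"

definition path_interval :: "('a, 'b) pre_digraph \<Rightarrow> 'a \<Rightarrow> 'a \<Rightarrow> 'a set" where
  "path_interval G u v =
     {x. \<exists>p. shortest_path G u p v \<and> x \<in> set (pre_digraph.awalk_verts G u p)}"

definition strongly_resolves :: "('a, 'b) pre_digraph \<Rightarrow> 'a \<Rightarrow> 'a \<Rightarrow> 'a \<Rightarrow> bool" where
  "strongly_resolves G w u v \<longleftrightarrow> v \<in> path_interval G u w \<or> u \<in> path_interval G v w"

definition strong_resolving_set :: "('a, 'b) pre_digraph \<Rightarrow> 'a set \<Rightarrow> bool" where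
  "strong_resolving_set G S \<longleftrightarrow> S \<subseteq> verts G \<and>
     (\<forall>u\<in>verts G. \<forall>v\<in>verts G. u \<noteq> v \<longrightarrow> (\<exists>w\<in>S. strongly_resolves G w u v))"

definition strong_metric_dim :: "('a, 'b) pre_digraph \<Rightarrow> nat" where
  "strong_metric_dim G = (LEAST k. \<exists>S. strong_resolving_set G S \<and> card S = k)"


subsection \<open>Laplacian matrix and algebraic connectivity\<close>

text \<open>
  Rows and columns are indexed by the positions in a list \<open>vs\<close> that enumerates the vertices
  without repetition.
\<close>

definition degree_mat :: "('a, 'b) pre_digraph \<Rightarrow> 'a list \<Rightarrow> real mat" where
  "degree_mat G vs = mat (length vs) (length vs)
     (\<lambda>(i, j). if i = j then real (out_degree G (vs ! i)) else 0)"

definition adjacency_mat :: "('a, 'b) pre_digraph \<Rightarrow> 'a list \<Rightarrow> real mat" where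
  "adjacency_mat G vs = mat (length vs) (length vs)
     (\<lambda>(i, j). if vs ! i \<rightarrow>\<^bsub>G\<^esub> vs ! j then 1 else 0)"

definition laplacian_mat :: "('a, 'b) pre_digraph \<Rightarrow> 'a list \<Rightarrow> real mat" where
  "laplacian_mat G vs = degree_mat G vs - adjacency_mat G vs"

definition vertex_enum :: "('a, 'b) pre_digraph \<Rightarrow> 'a list" where
  "vertex_enum G = (SOME vs. distinct vs \<and> set vs = verts G)"

text \<open>
  The eigenvalues are listed in increasing order with multiplicity. The Laplacian is a real
  symmetric matrix, so all roots of its characteristic polynomial are real and the list has one
  entry per vertex; position 1 is the second smallest.
\<close>

definition laplacian_spectrum :: "('a, 'b) pre_digraph \<Rightarrow> real list" where
  "laplacian_spectrum G =
     sorted_list_of_multiset (proots (char_poly (laplacian_mat G (vertex_enum G))))"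

definition algebraic_connectivity :: "('a, 'b) pre_digraph \<Rightarrow> real" where
  "algebraic_connectivity G = laplacian_spectrum G ! 1"

text \<open>The choice of the enumeration is immaterial.\<close>

lemma similar_mat_reindex:
  fixes f :: "'a \<Rightarrow> 'a \<Rightarrow> real"
  assumes "distinct vs" "distinct ws" "set vs = set ws"
  shows "similar_mat (mat (length vs) (length vs) (\<lambda>(i, j). f (vs ! i) (vs ! j)))
                     (mat (length ws) (length ws) (\<lambda>(i, j). f (ws ! i) (ws ! j)))"
proof -
  define n where "n = length ws"
  have n: "length vs = n" unfolding n_def using assms by (metis distinct_card)
  define P where "P us xs = mat n n (\<lambda>(i, j). if us ! i = (xs ! j :: 'a) then 1 else (0 :: real))"
    for us xs
  have sum1: "(\<Sum>k<n. (if x = us ! k then 1 else 0) * g (us ! k)) = (g x :: real)"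
    if "distinct us" "length us = n" "x \<in> set us" for us g and x :: 'a
  proof -
    have "(\<Sum>k<n. (if x = us ! k then 1 else 0) * g (us ! k))
        = (\<Sum>y\<in>set us. (if x = y then 1 else 0) * g y)"
      by (rule sum.reindex_bij_betw[OF bij_betw_nth]) (use that in auto)
    also have "\<dots> = g x"
      using that by (simp add: if_distrib[where f = "\<lambda>c. c * _"] cong: if_cong)
    finally show ?thesis .
  qed
  have inv: "P us xs * P xs us = 1\<^sub>m n"
    if "distinct us" "distinct xs" "length us = n" "length xs = n" "set us = set xs" for us xs
  proof (rule eq_matI)
    fix i j assume ij: "i < dim_row (1\<^sub>m n :: real mat)" "j < dim_col (1\<^sub>m n :: real mat)"
    have m: "us ! i \<in> set xs" using ij(1) that(3) unfolding that(5)[symmetric] by simp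
    from ij have "(P us xs * P xs us) $$ (i, j)
      = (\<Sum>k<n. (if us ! i = xs ! k then 1 else 0) * (if xs ! k = us ! j then 1 else 0))"
      by (simp add: P_def scalar_prod_def lessThan_atLeast0)
    also have "\<dots> = (if us ! i = us ! j then 1 else 0)"
      by (rule sum1[where g = "\<lambda>y. if y = us ! j then 1 else 0"]) (use that(2,4) m in auto)
    finally show "(P us xs * P xs us) $$ (i, j) = 1\<^sub>m n $$ (i, j)"
      using ij that(1,3) by (simp add: nth_eq_iff_index_eq)
  qed (auto simp: P_def)
  let ?A = "mat n n (\<lambda>(i, j). f (vs ! i) (vs ! j))"
  let ?B = "mat n n (\<lambda>(i, j). f (ws ! i) (ws ! j))"
  have mem: "vs ! i \<in> set ws" if "i < n" for i
    using that n assms(3) nth_mem by blast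
  have PB: "P vs ws * ?B = mat n n (\<lambda>(i, j). f (vs ! i) (ws ! j))"
  proof (rule eq_matI; clarsimp)
    fix i j assume ij: "i < n" "j < n"
    then have "(P vs ws * ?B) $$ (i, j)
      = (\<Sum>k<n. (if vs ! i = ws ! k then 1 else 0) * f (ws ! k) (ws ! j))"
      by (simp add: P_def scalar_prod_def lessThan_atLeast0)
    also have "\<dots> = f (vs ! i) (ws ! j)"
      by (rule sum1[where g = "\<lambda>y. f y (ws ! j)"]) (use assms(2) n_def mem ij in auto)
    finally show "(P vs ws * ?B) $$ (i, j) = f (vs ! i) (ws ! j)" .
  qed (auto simp: P_def)
  have "?A = P vs ws * ?B * P ws vs"
    unfolding PB
  proof (rule eq_matI)
    fix i j
    assume ij': "i < dim_row (mat n n (\<lambda>(i, j). f (vs ! i) (ws ! j)) * P ws vs)"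
      "j < dim_col (mat n n (\<lambda>(i, j). f (vs ! i) (ws ! j)) * P ws vs)"
    then have ij: "i < n" "j < n" by (auto simp: P_def)
    have "(mat n n (\<lambda>(i, j). f (vs ! i) (ws ! j)) * P ws vs) $$ (i, j)
      = (\<Sum>k<n. (if vs ! j = ws ! k then 1 else 0) * f (vs ! i) (ws ! k))"
      using ij by (auto simp: P_def scalar_prod_def lessThan_atLeast0 intro!: sum.cong)
    also have "\<dots> = f (vs ! i) (vs ! j)"
      by (rule sum1[where g = "\<lambda>y. f (vs ! i) y"]) (use assms(2) n_def mem ij in auto)
    finally show "?A $$ (i, j) = (mat n n (\<lambda>(i, j). f (vs ! i) (ws ! j)) * P ws vs) $$ (i, j)"
      using ij by simp
  qed (auto simp: P_def)
  moreover have "P vs ws * P ws vs = 1\<^sub>m n" "P ws vs * P vs ws = 1\<^sub>m n"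
    using inv assms n n_def by auto
  ultimately have "similar_mat_wit ?A ?B (P vs ws) (P ws vs)"
    unfolding similar_mat_wit_def Let_def by (auto simp: P_def)
  then show ?thesis
    unfolding similar_mat_def n n_def[symmetric] by blast
qed

lemma laplacian_spectrum_eq:
  assumes "distinct vs" "set vs = verts G"
  shows "laplacian_spectrum G = sorted_list_of_multiset (proots (char_poly (laplacian_mat G vs)))"
proof -
  define f where "f u v = (if u = v then real (out_degree G u) else 0)
    - (if u \<rightarrow>\<^bsub>G\<^esub> v then 1 else 0)" for u v
  have L: "laplacian_mat G us = mat (length us) (length us) (\<lambda>(i, j). f (us ! i) (us ! j))"
    if "distinct us" for us
    using that by (intro eq_matI)
      (auto simp: laplacian_mat_def degree_mat_def adjacency_mat_def f_def nth_eq_iff_index_eq)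
  have ws: "distinct (vertex_enum G) \<and> set (vertex_enum G) = verts G"
    unfolding vertex_enum_def by (rule someI[of _ vs]) (use assms in simp)
  have "char_poly (laplacian_mat G (vertex_enum G)) = char_poly (laplacian_mat G vs)"
    using ws assms by (intro char_poly_similar) (simp add: L similar_mat_reindex)
  then show ?thesis by (simp add: laplacian_spectrum_def)
qed

end

theory Submission
  imports Defs "HOL-Analysis.Function_Topology"
begin

text \<open>
  In a graph of diameter two, nonadjacent vertices are strongly resolved only by one of
  themselves, so the complement of a strong resolving set is a clique. The size of a clique \<open>T\<close> is
  bounded by inserting the projection of its indicator function onto the complement of the
  constants into the inequality \<open>\<mu> \<cdot> (\<Sum>v. (g v)\<^sup>2) \<le> \<langle>g, L g\<rangle>\<close>, valid whenever \<open>(\<Sum>v. g v) = 0\<close>.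

  That inequality needs no spectral theorem: by compactness the Rayleigh quotient attains its
  minimum \<open>m\<close> on the complement of the constants, and the minimizer is an eigenfunction. Since the
  graph is connected, \<open>m > 0\<close>, so \<open>0\<close> and \<open>m\<close> are two distinct roots of the characteristic
  polynomial and the second smallest root is at most \<open>m\<close>.
\<close>

section \<open>Rayleigh quotients on the complement of the constant functions\<close>

text \<open>First-order condition for a minimum at \<open>t = 0\<close>: near 0 the linear term
  dominates the quadratic one, so a nonzero \<open>b\<close> would make the expression negative on
  one side.\<close>

lemma linear_coefficient_eq_0:
  fixes b c :: real
  assumes "\<And>t. 0 \<le> 2 * t * b + t\<^sup>2 * c"
  shows "b = 0"
proof (rule ccontr)
  assume b: "b \<noteq> 0"
  define d where "d = \<bar>c\<bar> + 1"
  have d: "d > 0" "c < d" by (auto simp: d_def)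
  \<comment> \<open>The sign of \<open>t\<close> is opposite to that of \<open>b\<close>, and
    dividing by \<open>d > c\<close> keeps it so short that the quadratic term cannot
    compensate.\<close>
  have "0 \<le> 2 * (- b / d) * b + (- b / d)\<^sup>2 * c" by (rule assms)
  also have "\<dots> = b\<^sup>2 / d\<^sup>2 * (c - 2 * d)"
    using d by (simp add: field_simps power2_eq_square)
  also have "\<dots> < 0"
    using b d by (intro mult_pos_neg) auto
  finally show False by simp
qed

text \<open>The zero-sum functions of norm 1 form a compact set on which the quadratic form is
  continuous. Homogeneity of degree two carries the minimum over to all zero-sum
  \<open>g\<close>.\<close>

lemma rayleigh_minimizer:
  fixes L :: "'a \<Rightarrow> 'a \<Rightarrow> real"
  assumes fin: "finite V" and V: "card V \<ge> 2"
  obtains f where "(\<Sum>v\<in>V. f v) = 0" "(\<Sum>v\<in>V. (f v)\<^sup>2) = 1"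
    "\<And>g. (\<Sum>v\<in>V. g v) = 0 \<Longrightarrow>
      (\<Sum>u\<in>V. \<Sum>v\<in>V. f u * L u v * f v) * (\<Sum>v\<in>V. (g v)\<^sup>2) \<le> (\<Sum>u\<in>V. \<Sum>v\<in>V. g u * L u v * g v)"
proof -
  define Q where "Q f = (\<Sum>u\<in>V. \<Sum>v\<in>V. f u * L u v * f v)" for f
  \<comment> \<open>Functions live on the whole type, so they are pinned to 0 outside
    \<open>V\<close>; every factor is then compact and Tychonoff's theorem applies. The bounds on
    \<open>V\<close> lose nothing, as a function of norm 1 has its values in
    \<open>{-1..1}\<close>.\<close>
  define B where "B = (PiE UNIV (\<lambda>v. if v \<in> V then {-1..1} else {0 :: real}))"
  define K where "K = B \<inter> ({f. (\<Sum>v\<in>V. f v) = 0} \<inter> {f. (\<Sum>v\<in>V. (f v)\<^sup>2) = 1})"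
  have "compactin (product_topology (\<lambda>_. euclidean) UNIV) B"
    unfolding B_def by (subst compactin_PiE) auto
  then have "compact B"
    by (simp add: euclidean_product_topology)
  moreover have "closed ({f. (\<Sum>v\<in>V. f v) = 0} \<inter> {f. (\<Sum>v\<in>V. (f v)\<^sup>2) = (1::real)})"
    by (intro closed_Int closed_Collect_eq continuous_intros continuous_on_product_coordinates)
  ultimately have K: "compact K"
    unfolding K_def by blast
  have norm_in_K: "(\<lambda>v. if v \<in> V then g v / sqrt (\<Sum>v\<in>V. (g v)\<^sup>2) else 0) \<in> K"
    if "(\<Sum>v\<in>V. g v) = 0" "(\<Sum>v\<in>V. (g v)\<^sup>2) > 0" for g
  proof -
    define s where "s = (\<Sum>v\<in>V. (g v)\<^sup>2)"
    have s: "s > 0" using that by (simp add: s_def)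
    have "\<bar>g v\<bar> \<le> sqrt s" if "v \<in> V" for v
    proof -
      have "(g v)\<^sup>2 \<le> s"
        unfolding s_def by (rule member_le_sum) (use that fin in auto)
      then show ?thesis using real_le_rsqrt by fastforce
    qed
    then have "g v / sqrt s \<in> {-1..1}" if "v \<in> V" for v
      using that s by (simp add: abs_le_iff pos_le_divide_eq pos_divide_le_eq minus_le_iff)
    then have "(\<lambda>v. if v \<in> V then g v / sqrt s else 0) \<in> B"
      by (auto simp: B_def PiE_UNIV_domain)
    moreover have "(\<Sum>v\<in>V. if v \<in> V then g v / sqrt s else 0) = 0"
      using that(1) by (simp add: sum_divide_distrib[symmetric] cong: sum.cong)
    moreover have "(\<Sum>v\<in>V. (if v \<in> V then g v / sqrt s else 0)\<^sup>2) = (\<Sum>v\<in>V. (g v)\<^sup>2 / s)"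
      using s by (intro sum.cong) (auto simp: power_divide)
    then have "(\<Sum>v\<in>V. (if v \<in> V then g v / sqrt s else 0)\<^sup>2) = 1"
      using s by (simp add: sum_divide_distrib[symmetric] s_def[symmetric])
    ultimately show ?thesis
      unfolding K_def s_def[symmetric] by blast
  qed
  have "K \<noteq> {}"
  proof -
    obtain a b where ab: "a \<in> V" "b \<in> V" "a \<noteq> b"
      using V fin by (metis card_le_Suc0_iff_eq not_less_eq_eq numeral_2_eq_2)
    \<comment> \<open>The difference of the indicators of two vertices is zero-sum and nonzero; this
      is where \<open>card V \<ge> 2\<close> enters.\<close>
    define g where "g v = (if v = a then 1 else 0) - (if v = b then 1 else (0::real))" for v
    have "(\<Sum>v\<in>V. g v) = 0"
      using ab fin by (simp add: g_def sum_subtractf)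
    moreover have "(\<Sum>v\<in>V. (g v)\<^sup>2) > 0"
      by (rule sum_pos2[OF fin ab(1)]) (use ab in \<open>auto simp: g_def\<close>)
    ultimately show ?thesis using norm_in_K by blast
  qed
  moreover have "continuous_on K Q"
    unfolding Q_def
    by (intro continuous_intros continuous_on_subset[OF continuous_on_product_coordinates]) auto
  ultimately obtain f where f: "f \<in> K" "\<And>g. g \<in> K \<Longrightarrow> Q f \<le> Q g"
    using continuous_attains_inf[OF K] by metis
  show ?thesis
  proof (rule that)
    show "(\<Sum>v\<in>V. f v) = 0" "(\<Sum>v\<in>V. (f v)\<^sup>2) = 1"
      using f(1) by (auto simp: K_def)
    fix g :: "'a \<Rightarrow> real" assume g: "(\<Sum>v\<in>V. g v) = 0"
    define s where "s = (\<Sum>v\<in>V. (g v)\<^sup>2)"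
    show "(\<Sum>u\<in>V. \<Sum>v\<in>V. f u * L u v * f v) * (\<Sum>v\<in>V. (g v)\<^sup>2) \<le> (\<Sum>u\<in>V. \<Sum>v\<in>V. g u * L u v * g v)"
    proof (cases "s > 0")
      case True
      have "Q f \<le> Q (\<lambda>v. if v \<in> V then g v / sqrt s else 0)"
        using f(2)[OF norm_in_K[OF g]] True by (simp only: s_def)
      also have "\<dots> = (\<Sum>u\<in>V. \<Sum>v\<in>V. g u * L u v * g v / s)"
        unfolding Q_def using True by (intro sum.cong) (auto simp: field_simps)
      also have "\<dots> = Q g / s"
        by (simp add: Q_def sum_divide_distrib)
      finally show ?thesis
        using True unfolding Q_def[symmetric] s_def[symmetric] by (simp add: pos_le_divide_eq)
    next
      case False
      moreover have "s \<ge> 0" unfolding s_def by (intro sum_nonneg) auto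
      ultimately have "s = 0" by simp
      then have "\<forall>v\<in>V. g v = 0"
        unfolding s_def using fin by (subst (asm) sum_nonneg_eq_0_iff) auto
      then show ?thesis by simp
    qed
  qed
qed

text \<open>The minimizer \<open>f\<close> is a critical point: varying it in the direction of its
  own residual \<open>L f - m f\<close> forces that residual to vanish. Symmetry and zero row sums
  make the residual zero-sum, so the variation stays admissible.\<close>

lemma rayleigh_eigenfunction:
  fixes L :: "'a \<Rightarrow> 'a \<Rightarrow> real"
  assumes fin: "finite V" and V: "card V \<ge> 2"
    and sym: "\<And>u v. u \<in> V \<Longrightarrow> v \<in> V \<Longrightarrow> L u v = L v u"
    and row: "\<And>u. u \<in> V \<Longrightarrow> (\<Sum>v\<in>V. L u v) = 0"
  obtains m f where "(\<Sum>v\<in>V. f v) = 0" "(\<Sum>v\<in>V. (f v)\<^sup>2) = 1"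
    "\<And>u. u \<in> V \<Longrightarrow> (\<Sum>v\<in>V. L u v * f v) = m * f u"
    "\<And>g. (\<Sum>v\<in>V. g v) = 0 \<Longrightarrow>
      m * (\<Sum>v\<in>V. (g v)\<^sup>2) \<le> (\<Sum>u\<in>V. \<Sum>v\<in>V. g u * L u v * g v)"
proof -
  obtain f where f0: "(\<Sum>v\<in>V. f v) = 0" and f1: "(\<Sum>v\<in>V. (f v)\<^sup>2) = 1"
    and fmin: "\<And>g. (\<Sum>v\<in>V. g v) = 0 \<Longrightarrow>
      (\<Sum>u\<in>V. \<Sum>v\<in>V. f u * L u v * f v) * (\<Sum>v\<in>V. (g v)\<^sup>2) \<le> (\<Sum>u\<in>V. \<Sum>v\<in>V. g u * L u v * g v)"
    by (rule rayleigh_minimizer[OF fin V, of L]) blast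
  define m where "m = (\<Sum>u\<in>V. \<Sum>v\<in>V. f u * L u v * f v)"
  \<comment> \<open>\<open>R\<close> is the operator \<open>L - m\<close>. Its quadratic form is
    nonnegative on zero-sum functions and vanishes at \<open>f\<close>.\<close>
  define R where "R g u = (\<Sum>v\<in>V. L u v * g v) - m * g u" for g u
  have form: "(\<Sum>u\<in>V. g u * R g u) = (\<Sum>u\<in>V. \<Sum>v\<in>V. g u * L u v * g v) - m * (\<Sum>v\<in>V. (g v)\<^sup>2)" for g
    by (simp add: R_def algebra_simps sum_subtractf sum_distrib_left power2_eq_square)
  have col: "(\<Sum>u\<in>V. L u v) = 0" if "v \<in> V" for v
    using row[OF that] sym that by (metis (mono_tags, lifting) sum.cong)
  have sumR: "(\<Sum>u\<in>V. R f u) = 0"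
  proof -
    have "(\<Sum>u\<in>V. \<Sum>v\<in>V. L u v * f v) = (\<Sum>v\<in>V. (\<Sum>u\<in>V. L u v) * f v)"
      by (subst sum.swap) (simp add: sum_distrib_right)
    then show ?thesis
      using f0 col by (simp add: R_def sum_subtractf sum_distrib_left[symmetric])
  qed
  have self_adjoint: "(\<Sum>u\<in>V. g u * R h u) = (\<Sum>u\<in>V. h u * R g u)" for g h
  proof -
    have "(\<Sum>u\<in>V. \<Sum>v\<in>V. g u * (L u v * h v)) = (\<Sum>u\<in>V. \<Sum>v\<in>V. h u * (L u v * g v))"
      by (subst sum.swap) (intro sum.cong refl, simp add: sym mult_ac)
    then show ?thesis
      by (simp add: R_def right_diff_distrib sum_subtractf sum_distrib_left mult_ac)
  qed
  \<comment> \<open>Expanding the form of \<open>R\<close> at \<open>f + t * R f\<close>,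
    self-adjointness merges the two cross terms, so the linear coefficient is twice the squared norm
    of \<open>R f\<close>.\<close>
  have "(\<Sum>u\<in>V. R f u * R f u) = 0"
  proof (rule linear_coefficient_eq_0)
    fix t :: real
    define g where "g v = f v + t * R f v" for v
    have "(\<Sum>v\<in>V. g v) = 0"
      using f0 sumR by (simp add: g_def sum.distrib sum_distrib_left[symmetric])
    then have "0 \<le> (\<Sum>u\<in>V. g u * R g u)"
      using fmin by (simp add: form m_def)
    also have "R g u = R f u + t * R (R f) u" for u
      by (simp add: R_def[of g] R_def[of "R f"] R_def[of f] g_def algebra_simps sum.distrib
          sum_distrib_left sum_subtractf)
    then have "(\<Sum>u\<in>V. g u * R g u) = (\<Sum>u\<in>V. f u * R f u) + t * (\<Sum>u\<in>V. R f u * R f u)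
        + t * (\<Sum>u\<in>V. f u * R (R f) u) + t\<^sup>2 * (\<Sum>u\<in>V. R f u * R (R f) u)"
      by (simp add: g_def algebra_simps sum.distrib sum_distrib_left power2_eq_square)
    also have "(\<Sum>u\<in>V. f u * R f u) = 0"
      by (simp add: form f1 m_def)
    also have "(\<Sum>u\<in>V. f u * R (R f) u) = (\<Sum>u\<in>V. R f u * R f u)"
      by (rule self_adjoint)
    finally show "0 \<le> 2 * t * (\<Sum>u\<in>V. R f u * R f u) + t\<^sup>2 * (\<Sum>u\<in>V. R f u * R (R f) u)"
      by simp
  qed
  then have "\<forall>u\<in>V. R f u = 0"
    using fin by (subst (asm) sum_nonneg_eq_0_iff) auto
  then show ?thesis
    by (intro that[OF f0 f1, of m]) (auto simp: R_def m_def fmin)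
qed

section \<open>The Laplacian spectrum\<close>

text \<open>Without parallel arcs, an arc leaving \<open>u\<close> is determined by its
  head.\<close>

lemma (in digraph) out_degree_eq_sum:
  "real (out_degree G u) = (\<Sum>v\<in>verts G. if u \<rightarrow>\<^bsub>G\<^esub> v then 1 else 0)"
proof -
  have "bij_betw (head G) (out_arcs G u) {v \<in> verts G. u \<rightarrow>\<^bsub>G\<^esub> v}"
    unfolding bij_betw_def
  proof
    show "inj_on (head G) (out_arcs G u)"
      by (auto intro!: inj_onI no_multi_arcs simp: arc_to_ends_def)
    show "head G ` out_arcs G u = {v \<in> verts G. u \<rightarrow>\<^bsub>G\<^esub> v}"
      by (auto simp: arcs_ends_conv image_iff)
  qed
  then show ?thesis
    by (simp add: out_degree_def bij_betw_same_card sum.If_cases Int_def)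
qed

text \<open>Indexing by vertices instead of list positions keeps the analytic argument free of
  enumerations.\<close>

definition laplacian :: "('a, 'b) pre_digraph \<Rightarrow> 'a \<Rightarrow> 'a \<Rightarrow> real" where
  "laplacian G u v = (if u = v then real (out_degree G u) else 0) - (if u \<rightarrow>\<^bsub>G\<^esub> v then 1 else 0)"

lemma laplacian_mat_conv:
  assumes "distinct vs"
  shows "laplacian_mat G vs = mat (length vs) (length vs) (\<lambda>(i, j). laplacian G (vs ! i) (vs ! j))"
  using assms by (intro eq_matI)
    (auto simp: laplacian_mat_def degree_mat_def adjacency_mat_def laplacian_def nth_eq_iff_index_eq)

text \<open>Bridge from eigenfunctions to matrices: the values of \<open>f\<close> read along
  \<open>vs\<close> form an eigenvector, nonzero because \<open>f\<close> is nonzero at some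
  vertex.\<close>

lemma poly_char_poly_laplacian_eq_0:
  assumes vs: "distinct vs" "set vs = verts G"
    and f: "v \<in> verts G" "f v \<noteq> 0"
    and eigen: "\<And>u. u \<in> verts G \<Longrightarrow> (\<Sum>v\<in>verts G. laplacian G u v * f v) = m * f u"
  shows "poly (char_poly (laplacian_mat G vs)) m = 0"
proof -
  let ?A = "laplacian_mat G vs" and ?n = "length vs"
  define x where "x = vec ?n (\<lambda>i. f (vs ! i))"
  have A: "?A \<in> carrier_mat ?n ?n" by (simp add: laplacian_mat_conv vs)
  have "?A *\<^sub>v x = m \<cdot>\<^sub>v x"
  proof (rule eq_vecI)
    fix i assume "i < dim_vec (m \<cdot>\<^sub>v x)"
    then have i: "i < ?n" by (simp add: x_def)
    then have "(?A *\<^sub>v x) $ i = (\<Sum>k<?n. laplacian G (vs ! i) (vs ! k) * f (vs ! k))"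
      by (simp add: laplacian_mat_conv vs x_def scalar_prod_def lessThan_atLeast0)
    also have "\<dots> = (\<Sum>v\<in>verts G. laplacian G (vs ! i) v * f v)"
      by (rule sum.reindex_bij_betw[OF bij_betw_nth]) (use vs in auto)
    also have "\<dots> = m * f (vs ! i)"
      using eigen[of "vs ! i"] nth_mem[OF i] vs(2) by blast
    finally show "(?A *\<^sub>v x) $ i = (m \<cdot>\<^sub>v x) $ i" using i by (simp add: x_def)
  qed (use A in \<open>auto simp: x_def\<close>)
  moreover obtain k where "k < ?n" "vs ! k = v" using f vs by (metis in_set_conv_nth)
  then have "x \<noteq> 0\<^sub>v ?n" using f by (auto simp: x_def vec_eq_iff)
  ultimately have "eigenvalue ?A m"
    using A unfolding eigenvalue_def eigenvector_def by (intro exI[of _ x]) (auto simp: x_def)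
  then show ?thesis using eigenvalue_root_char_poly[OF A] by simp
qed

text \<open>The entry \<open>b\<close> comes after the smaller entry \<open>a\<close>, hence at
  position 1 or later. With \<open>a = 0\<close>, this bounds the second smallest eigenvalue by any
  positive one, whatever the multiplicities.\<close>

lemma sorted_nth_1_le:
  assumes "sorted xs" "a \<in> set xs" "b \<in> set xs" "a < b"
  shows "xs ! 1 \<le> b"
proof -
  obtain i j where ij: "i < length xs" "xs ! i = a" "j < length xs" "xs ! j = b"
    using assms by (metis in_set_conv_nth)
  have "i < j"
    using ij assms by (metis not_less sorted_nth_mono)
  then show ?thesis using ij assms(1) sorted_nth_mono[of xs 1 j] by auto
qed

context graph
begin

lemma laplacian_sym: "laplacian G u v = laplacian G v u"
  using graph_symmetric unfolding laplacian_def by auto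

lemma laplacian_row_sum: "u \<in> verts G \<Longrightarrow> (\<Sum>v\<in>verts G. laplacian G u v) = 0"
  by (simp add: laplacian_def sum_subtractf out_degree_eq_sum)

text \<open>Each edge contributes the square of the difference across it; ordered pairs count every
  edge twice, whence the division by 2. This form shows nonnegativity and invariance under adding
  constants.\<close>

lemma laplacian_form:
  "(\<Sum>u\<in>verts G. \<Sum>v\<in>verts G. g u * laplacian G u v * g v)
    = (\<Sum>u\<in>verts G. \<Sum>v\<in>verts G. if u \<rightarrow>\<^bsub>G\<^esub> v then (g u - g v)\<^sup>2 else 0) / 2"
proof -
  let ?V = "verts G"
  define a where "a u v = (if u \<rightarrow>\<^bsub>G\<^esub> v then 1 else 0 :: real)" for u v
  have sym: "a u v = a v u" for u v
    using graph_symmetric by (auto simp: a_def)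
  have 1: "(\<Sum>v\<in>?V. g u * laplacian G u v * g v) = (\<Sum>v\<in>?V. a u v * (g u)\<^sup>2) - (\<Sum>v\<in>?V. a u v * g u * g v)"
    if "u \<in> ?V" for u
  proof -
    have "(\<Sum>v\<in>?V. g u * laplacian G u v * g v)
      = (\<Sum>v\<in>?V. if u = v then real (out_degree G u) * (g u)\<^sup>2 else 0) - (\<Sum>v\<in>?V. a u v * g u * g v)"
      unfolding sum_subtractf[symmetric]
      by (intro sum.cong) (auto simp: laplacian_def a_def algebra_simps power2_eq_square)
    also have "(\<Sum>v\<in>?V. if u = v then real (out_degree G u) * (g u)\<^sup>2 else 0) = (\<Sum>v\<in>?V. a u v * (g u)\<^sup>2)"
      using that by (simp add: out_degree_eq_sum sum_distrib_right a_def)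
    finally show ?thesis .
  qed
  have 2: "(\<Sum>u\<in>?V. \<Sum>v\<in>?V. a u v * (g v)\<^sup>2) = (\<Sum>u\<in>?V. \<Sum>v\<in>?V. a u v * (g u)\<^sup>2)"
    by (subst sum.swap) (simp add: sym)
  have "(\<Sum>u\<in>?V. \<Sum>v\<in>?V. if u \<rightarrow>\<^bsub>G\<^esub> v then (g u - g v)\<^sup>2 else 0)
    = (\<Sum>u\<in>?V. \<Sum>v\<in>?V. a u v * (g u)\<^sup>2 + a u v * (g v)\<^sup>2 - 2 * (a u v * g u * g v))"
    by (intro sum.cong refl) (auto simp: a_def power2_eq_square algebra_simps)
  also have "\<dots> = 2 * (\<Sum>u\<in>?V. \<Sum>v\<in>?V. g u * laplacian G u v * g v)"
    by (simp add: 1 2 sum_subtractf sum.distrib sum_distrib_left[symmetric])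
  finally show ?thesis by simp
qed

text \<open>A vanishing sum of squares forces equality across each edge, and connectedness
  propagates it along walks.\<close>

lemma laplacian_form_eq_0_const:
  assumes "connected G"
    and "(\<Sum>u\<in>verts G. \<Sum>v\<in>verts G. g u * laplacian G u v * g v) = 0"
    and "u \<in> verts G" "v \<in> verts G"
  shows "g u = g v"
proof -
  have "(\<Sum>u\<in>verts G. \<Sum>v\<in>verts G. if u \<rightarrow>\<^bsub>G\<^esub> v then (g u - g v)\<^sup>2 else 0) = 0"
    using assms(2) by (simp add: laplacian_form)
  then have "\<forall>x\<in>verts G. (\<Sum>y\<in>verts G. if x \<rightarrow>\<^bsub>G\<^esub> y then (g x - g y)\<^sup>2 else 0) = 0"
    by (subst (asm) sum_nonneg_eq_0_iff) (auto intro: sum_nonneg)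
  then have "\<forall>x\<in>verts G. \<forall>y\<in>verts G. (if x \<rightarrow>\<^bsub>G\<^esub> y then (g x - g y)\<^sup>2 else 0) = 0"
    by (subst (asm) sum_nonneg_eq_0_iff) auto
  then have adj: "g x = g y" if "x \<rightarrow>\<^bsub>G\<^esub> y" for x y
    using that adj_in_verts[OF that] by fastforce
  have "u \<rightarrow>\<^sup>*\<^bsub>G\<^esub> v"
    using symmetric_connected_imp_strongly_connected[OF sym_arcs assms(1)] assms(3,4)
    by (auto simp: strongly_connected_def)
  then show ?thesis
    unfolding reachable_def by (induction rule: rtrancl_on_induct) (auto dest: adj)
qed

theorem algebraic_connectivity_le_rayleigh:
  assumes conn: "connected G" and V: "card (verts G) \<ge> 2" and g: "(\<Sum>v\<in>verts G. g v) = 0"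
  shows "algebraic_connectivity G * (\<Sum>v\<in>verts G. (g v)\<^sup>2)
    \<le> (\<Sum>u\<in>verts G. \<Sum>v\<in>verts G. g u * laplacian G u v * g v)"
proof -
  let ?V = "verts G"
  obtain m f where f0: "(\<Sum>v\<in>?V. f v) = 0" and f1: "(\<Sum>v\<in>?V. (f v)\<^sup>2) = 1"
    and eigen: "\<And>u. u \<in> ?V \<Longrightarrow> (\<Sum>v\<in>?V. laplacian G u v * f v) = m * f u"
    and min: "\<And>g. (\<Sum>v\<in>?V. g v) = 0 \<Longrightarrow>
      m * (\<Sum>v\<in>?V. (g v)\<^sup>2) \<le> (\<Sum>u\<in>?V. \<Sum>v\<in>?V. g u * laplacian G u v * g v)"
    by (rule rayleigh_eigenfunction[of ?V "laplacian G"])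
      (use V laplacian_sym laplacian_row_sum in auto)
  obtain v where v: "v \<in> ?V" "f v \<noteq> 0"
    using f1 by (metis (mono_tags, lifting) power_zero_numeral sum.neutral zero_neq_one)
  have form: "(\<Sum>u\<in>?V. \<Sum>v\<in>?V. f u * laplacian G u v * f v) = m"
  proof -
    have "(\<Sum>u\<in>?V. \<Sum>v\<in>?V. f u * laplacian G u v * f v) = (\<Sum>u\<in>?V. f u * (m * f u))"
      by (intro sum.cong refl) (simp add: eigen[symmetric] sum_distrib_left mult_ac)
    also have "\<dots> = m * (\<Sum>v\<in>?V. (f v)\<^sup>2)"
      by (simp add: sum_distrib_left power2_eq_square mult_ac)
    finally show ?thesis by (simp add: f1)
  qed
  have "m \<ge> 0"
    unfolding form[symmetric] laplacian_form by (intro divide_nonneg_nonneg sum_nonneg) auto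
  \<comment> \<open>If \<open>m = 0\<close>, the minimizer is constant; being zero-sum it vanishes,
    contradicting \<open>f v \<noteq> 0\<close>.\<close>
  moreover have "m \<noteq> 0"
  proof
    assume "m = 0"
    then have "f u = f v" if "u \<in> ?V" for u
      using laplacian_form_eq_0_const[OF conn, of f u v] form that v by simp
    then have "(\<Sum>v\<in>?V. f v) = real (card ?V) * f v" by simp
    then show False using f0 v V by simp
  qed
  ultimately have m: "m > 0" by simp
  obtain vs where vs: "distinct vs" "set vs = ?V"
    using finite_distinct_list[OF finite_verts] by blast
  let ?p = "char_poly (laplacian_mat G vs)"
  \<comment> \<open>The characteristic polynomial is monic. For a nonzero polynomial, the elements
    of \<open>proots\<close> are exactly the roots.\<close>
  have p: "?p \<noteq> 0"
    using degree_monic_char_poly[of "laplacian_mat G vs" "length vs"] vs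
    by (auto simp: laplacian_mat_conv)
  have "poly ?p m = 0"
    by (rule poly_char_poly_laplacian_eq_0[where f = f]) (use vs v eigen in auto)
  moreover have "poly ?p 0 = 0"
    by (rule poly_char_poly_laplacian_eq_0[where f = "\<lambda>_. 1"])
      (use vs v laplacian_row_sum in auto)
  ultimately have "algebraic_connectivity G \<le> m"
    unfolding algebraic_connectivity_def laplacian_spectrum_eq[OF vs]
    by (intro sorted_nth_1_le[where a = 0]) (use p m in auto)
  then have "algebraic_connectivity G * (\<Sum>v\<in>?V. (g v)\<^sup>2) \<le> m * (\<Sum>v\<in>?V. (g v)\<^sup>2)"
    by (intro mult_right_mono sum_nonneg) auto
  also have "\<dots> \<le> (\<Sum>u\<in>?V. \<Sum>v\<in>?V. g u * laplacian G u v * g v)"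
    by (rule min[OF g])
  finally show ?thesis .
qed

section \<open>Cliques and strong resolving sets\<close>

lemma out_degree_le_max_degree: "u \<in> verts G \<Longrightarrow> out_degree G u \<le> max_degree G"
  unfolding max_degree_def by (intro Max_ge) auto

lemma max_degree_less_card:
  assumes "verts G \<noteq> {}"
  shows "max_degree G < card (verts G)"
proof -
  have "out_degree G u < card (verts G)" if "u \<in> verts G" for u
  proof -
    have "real (out_degree G u) < (\<Sum>v\<in>verts G. 1)"
      unfolding out_degree_eq_sum
      \<comment> \<open>Strictness comes from the term at \<open>u\<close> itself: there are no
        loops.\<close>
      by (rule sum_strict_mono_ex1) (use that adj_not_same in auto)
    then show ?thesis by simp
  qed
  then show ?thesis
    using assms unfolding max_degree_def by (subst Max_less_iff) auto
qed

text \<open>This is Hoffman's bound on independent sets, applied to the complement graph.\<close>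

lemma clique_card_bound:
  assumes conn: "connected G" and V: "card (verts G) \<ge> 2"
    and T: "T \<subseteq> verts G" "T \<noteq> {}"
    and clique: "\<And>u v. u \<in> T \<Longrightarrow> v \<in> T \<Longrightarrow> u \<noteq> v \<Longrightarrow> u \<rightarrow>\<^bsub>G\<^esub> v"
  shows "algebraic_connectivity G * (real (card (verts G)) - real (card T))
    \<le> real (card (verts G)) * (real (max_degree G) + 1 - real (card T))"
proof -
  let ?V = "verts G"
  define n where "n = real (card ?V)"
  define t where "t = real (card T)"
  have fT: "finite T" using T(1) finite_verts by (rule finite_subset)
  have t: "t > 0" using T fT by (simp add: t_def card_gt_0_iff)
  have n: "n > 0" using V by (simp add: n_def)
  define i where "i v = (if v \<in> T then 1 else 0 :: real)" for v
  have i1: "(\<Sum>v\<in>?V. i v) = t"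
    using T by (simp add: i_def t_def sum.If_cases Int_absorb1)
  \<comment> \<open>This is \<open>n\<close> times the projection of the indicator \<open>i\<close>
    onto the zero-sum functions; the scaling avoids fractions.\<close>
  define g where "g v = n * i v - t" for v
  have g0: "(\<Sum>v\<in>?V. g v) = 0"
    by (simp add: g_def sum_subtractf sum_distrib_left[symmetric] i1 n_def)
  have "(\<Sum>v\<in>?V. (g v)\<^sup>2) = (\<Sum>v\<in>?V. (n\<^sup>2 - 2 * n * t) * i v + t\<^sup>2)"
    by (intro sum.cong refl) (auto simp: g_def i_def power2_eq_square algebra_simps)
  also have "\<dots> = (n\<^sup>2 - 2 * n * t) * t + n * t\<^sup>2"
    by (simp add: sum.distrib sum_distrib_left[symmetric] i1 n_def)
  also have "\<dots> = n * t * (n - t)"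
    by (simp add: power2_eq_square algebra_simps)
  finally have g2: "(\<Sum>v\<in>?V. (g v)\<^sup>2) = n * t * (n - t)" .
  \<comment> \<open>The form sees only differences, so the shift by \<open>t\<close> cancels and
    \<open>g\<close> contributes \<open>n\<^sup>2\<close> times the form of
    \<open>i\<close>.\<close>
  have "(\<Sum>u\<in>?V. \<Sum>v\<in>?V. if u \<rightarrow>\<^bsub>G\<^esub> v then (g u - g v)\<^sup>2 else 0)
      = (\<Sum>u\<in>?V. \<Sum>v\<in>?V. n\<^sup>2 * (if u \<rightarrow>\<^bsub>G\<^esub> v then (i u - i v)\<^sup>2 else 0))"
    by (intro sum.cong refl) (simp add: g_def flip: right_diff_distrib power_mult_distrib)
  then have "(\<Sum>u\<in>?V. \<Sum>v\<in>?V. g u * laplacian G u v * g v)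
      = n\<^sup>2 * (\<Sum>u\<in>?V. \<Sum>v\<in>?V. i u * laplacian G u v * i v)"
    unfolding laplacian_form by (simp only: sum_distrib_left[symmetric] times_divide_eq_right)
  also have "(\<Sum>u\<in>?V. \<Sum>v\<in>?V. i u * laplacian G u v * i v) = (\<Sum>u\<in>T. \<Sum>v\<in>?V. laplacian G u v * i v)"
    by (rule sum.mono_neutral_cong_right) (use T in \<open>auto simp: i_def\<close>)
  also have "\<dots> = (\<Sum>u\<in>T. \<Sum>v\<in>T. laplacian G u v)"
    by (intro sum.cong refl sum.mono_neutral_cong_right) (use T in \<open>auto simp: i_def\<close>)
  also have "\<dots> \<le> (\<Sum>u\<in>T. real (max_degree G) + 1 - t)"
  proof (rule sum_mono)
    fix u assume u: "u \<in> T"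
    \<comment> \<open>Inside the clique, \<open>u\<close> is adjacent to all other members: the
      diagonal gives its degree and the \<open>t - 1\<close> other entries are -1.\<close>
    have "(\<Sum>v\<in>T. laplacian G u v) = (\<Sum>v\<in>T. (if u = v then real (out_degree G u) + 1 else 0) - 1)"
      using clique[OF u] adj_not_same by (intro sum.cong refl) (auto simp: laplacian_def)
    also have "\<dots> = real (out_degree G u) + 1 - t"
      using u fT by (simp add: sum_subtractf t_def)
    finally show "(\<Sum>v\<in>T. laplacian G u v) \<le> real (max_degree G) + 1 - t"
      using out_degree_le_max_degree u T by auto
  qed
  also have "\<dots> = t * (real (max_degree G) + 1 - t)"
    by (simp add: t_def)
  finally have "(\<Sum>u\<in>?V. \<Sum>v\<in>?V. g u * laplacian G u v * g v)
    \<le> n\<^sup>2 * (t * (real (max_degree G) + 1 - t))" by (simp add: mult_left_mono)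
  with algebraic_connectivity_le_rayleigh[OF conn V g0, unfolded g2]
  have "n * t * (algebraic_connectivity G * (n - t)) \<le> n * t * (n * (real (max_degree G) + 1 - t))"
    by (simp only: power2_eq_square mult_ac)
  then show ?thesis
    using n t by (simp add: n_def t_def)
qed

section \<open>Shortest paths and strong resolving sets in diameter at most two\<close>

lemma graph_dist_le_diameter:
  "u \<in> verts G \<Longrightarrow> v \<in> verts G \<Longrightarrow> graph_dist G u v \<le> graph_diameter G"
  unfolding graph_diameter_def by (rule SUP_upper2, assumption, rule SUP_upper)

lemma awalk_cost_1: "awalk_cost (\<lambda>_. 1) p = real (length p)"
  by (induction p) auto

lemma path_interval_endpoint:
  assumes "connected G" "u \<in> verts G" "v \<in> verts G"
  shows "v \<in> path_interval G u v"
proof -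
  have "u \<rightarrow>\<^sup>*\<^bsub>G\<^esub> v"
    using symmetric_connected_imp_strongly_connected[OF sym_arcs assms(1)] assms(2,3)
    by (auto simp: strongly_connected_def)
  then obtain p where p: "apath u p v" "\<mu> (\<lambda>_. 1) u v = awalk_cost (\<lambda>_. 1) p"
    using min_cost_awalk[of u v "\<lambda>_. 1"] by auto
  then have "shortest_path G u p v"
    by (simp add: shortest_path_def graph_dist_def awalk_cost_1)
  moreover have "v \<in> set (awalk_verts u p)"
    using p(1) last_in_set[of "awalk_verts u p"] by (auto simp: apath_def)
  ultimately show ?thesis
    by (auto simp: path_interval_def)
qed

text \<open>A shortest path has at most two arcs here, so each of its vertices is the start
  \<open>u\<close>, a neighbour of \<open>u\<close>, or the end \<open>w\<close>. The assumptions on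
  \<open>v\<close> leave only the end.\<close>

lemma path_interval_diameter_2:
  assumes diam: "graph_diameter G \<le> 2"
    and v: "v \<in> path_interval G u w" and w: "w \<in> verts G"
    and uv: "u \<noteq> v" "\<not> u \<rightarrow>\<^bsub>G\<^esub> v"
  shows "v = w"
proof -
  obtain p where p: "apath u p w" "ereal (real (length p)) = graph_dist G u w"
    "v \<in> set (awalk_verts u p)"
    using v by (auto simp: path_interval_def shortest_path_def)
  have aw: "awalk u p w" using p(1) by (simp add: apath_def)
  then have "u \<in> verts G" by blast
  then have "ereal (real (length p)) \<le> 2"
    using graph_dist_le_diameter[of u w] w diam p(2) by (metis order_trans)
  then have "length p \<le> 2" by simp
  then consider "p = []" | e where "p = [e]" | d e where "p = [d, e]"
    by (cases p; cases "tl p"; cases "tl (tl p)") auto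
  then show ?thesis
  proof cases
    case 1
    then show ?thesis using p(3) uv by simp
  next
    case 2
    then show ?thesis using p(3) uv aw by (auto simp: awalk_def)
  next
    case 3
    then have "u \<rightarrow>\<^bsub>G\<^esub> head G d" using aw by (auto simp: awalk_def arcs_ends_conv)
    then show ?thesis using p(3) uv aw 3 by (auto simp: awalk_def)
  qed
qed

text \<open>For a nonadjacent pair, the preceding lemma applied in both orders makes the resolving
  vertex one of the pair, but it lies in \<open>S\<close> and they do not.\<close>

lemma strong_resolving_set_complement_clique:
  assumes diam: "graph_diameter G \<le> 2" and S: "strong_resolving_set G S"
    and uv: "u \<in> verts G - S" "v \<in> verts G - S" "u \<noteq> v"
  shows "u \<rightarrow>\<^bsub>G\<^esub> v"
proof (rule ccontr)
  assume nadj: "\<not> u \<rightarrow>\<^bsub>G\<^esub> v"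
  then have nadj': "\<not> v \<rightarrow>\<^bsub>G\<^esub> u" using graph_symmetric by blast
  obtain w where w: "w \<in> S" "w \<in> verts G" "strongly_resolves G w u v"
    using S uv unfolding strong_resolving_set_def by blast
  then have "v = w \<or> u = w"
    unfolding strongly_resolves_def
    using path_interval_diameter_2[OF diam] nadj nadj' uv(3) by metis
  then show False using w uv by auto
qed

text \<open>Every pair is resolved by its own members, so the set of all vertices is strongly
  resolving and the \<open>LEAST\<close> ranges over a nonempty set.\<close>

lemma strong_metric_dim_attained:
  assumes "connected G"
  obtains S where "strong_resolving_set G S" "card S = strong_metric_dim G"
proof -
  have "strong_resolving_set G (verts G)"
    unfolding strong_resolving_set_def strongly_resolves_def
    using path_interval_endpoint[OF assms] by blast
  then have "\<exists>S. strong_resolving_set G S \<and> card S = card (verts G)" by blast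
  then show ?thesis
    using that LeastI[of "\<lambda>k. \<exists>S. strong_resolving_set G S \<and> card S = k"]
    unfolding strong_metric_dim_def by blast
qed

text \<open>The clique bound is applied to the complement of a minimum strong resolving set and
  solved for the size of that set. The product form holds whatever the sign of
  \<open>n - \<mu>\<close>.\<close>

lemma strong_metric_dim_lower_bound:
  assumes conn: "connected G" and V: "card (verts G) \<ge> 2" and diam: "graph_diameter G \<le> 2"
  shows "real (card (verts G)) * (real (card (verts G)) - real (max_degree G) - 1)
    \<le> real (strong_metric_dim G) * (real (card (verts G)) - algebraic_connectivity G)"
    (is "?n * (?n - ?\<Delta> - 1) \<le> _ * (?n - ?\<mu>)")
proof -
  obtain S where S: "strong_resolving_set G S" "card S = strong_metric_dim G"
    using strong_metric_dim_attained[OF conn] by blast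
  have SV: "S \<subseteq> verts G" using S by (simp add: strong_resolving_set_def)
  show ?thesis
  proof (cases "S = verts G")
    case False
    then have "?\<mu> * (?n - real (card (verts G - S))) \<le> ?n * (?\<Delta> + 1 - real (card (verts G - S)))"
      using SV strong_resolving_set_complement_clique[OF diam S(1)]
      by (intro clique_card_bound conn V) auto
    moreover have "real (card (verts G - S)) = ?n - real (card S)"
      using SV by (simp add: card_Diff_subset finite_subset card_mono of_nat_diff)
    ultimately show ?thesis
      by (simp add: S(2) algebra_simps)
  \<comment> \<open>The complement is empty, so the clique bound does not apply to it. The claim now
    reads \<open>\<mu> \<le> \<Delta> + 1\<close>, which follows from the bound for a single vertex
    together with \<open>\<Delta> \<le> n - 1\<close>.\<close>
  next
    case True
    obtain v where v: "v \<in> verts G" using V by (metis card.empty ex_in_conv not_numeral_le_zero)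
    have n: "?n > 1" using V by simp
    have "?\<mu> * (?n - 1) \<le> ?n * ?\<Delta>"
      using clique_card_bound[OF conn V, of "{v}"] v by simp
    also have "\<dots> \<le> (?\<Delta> + 1) * (?n - 1)"
      using max_degree_less_card v by (fastforce simp: algebra_simps)
    finally have "?\<mu> \<le> ?\<Delta> + 1" using n by simp
    then show ?thesis
      using n S True by (simp flip: S(2))
  qed
qed

end

theorem theorem13:
  fixes H :: "('a, 'b) pre_digraph" and n \<Delta> :: nat and \<mu> :: real
  assumes "Digraph.graph H"
    and "Digraph_Component.connected H"
    and "graph_diameter H = 2"
    and "n = card (verts H)"
    and "n \<ge> 2"
    and "\<Delta> = max_degree H"
    and "\<mu> = algebraic_connectivity H"
  shows "int (strong_metric_dim H)
    \<ge> \<lceil>real n * (real n - real \<Delta> - 1) / (real n - \<mu>)\<rceil>"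
proof -
  interpret graph H by fact
  have bound: "real n * (real n - real \<Delta> - 1) \<le> real (strong_metric_dim H) * (real n - \<mu>)"
    using strong_metric_dim_lower_bound assms by simp
  have "real n * (real n - real \<Delta> - 1) / (real n - \<mu>) \<le> real (strong_metric_dim H)"
  proof (cases "\<mu> < real n")
    case True
    then show ?thesis using bound by (simp add: divide_le_eq)
  next
    case False
    \<comment> \<open>For \<open>\<mu> \<ge> n\<close>, a nonnegative numerator makes the quotient
      at most 0; at \<open>\<mu> = n\<close> it is 0 by the convention for division by zero.\<close>
    have "\<Delta> < n" using max_degree_less_card assms by force
    then have "real n * (real n - real \<Delta> - 1) / (real n - \<mu>) \<le> 0"
      using False by (intro divide_nonneg_nonpos mult_nonneg_nonneg) auto
    then show ?thesis by (rule order_trans) simp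
  qed
  then show ?thesis
    by (simp add: ceiling_le_iff)
qed

end
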